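(* Let $n$ and $m$ be positive odd integers and let $\alpha,\beta$ be real numbers with $\alpha>0$ and $\alpha\beta=1$. Then $$\sum_{j=1}^{(3n-1)/2}\left(\frac{j}{3}\right)\arctan\frac{\sqrt{3}}{1+2\left(\frac{\alpha+\tan\frac{\pi j}{3n}}{\alpha-\tan\frac{\pi j}{3n}}\right)^{m}}+\sum_{k=1}^{(3m-1)/2}\left(\frac{k}{3}\right)\arctan\frac{\sqrt{3}}{1+2\left(\frac{\beta+\tan\frac{\pi k}{3m}}{\beta-\tan\frac{\pi k}{3m}}\right)^{n}}=-\frac{\pi}{6}.$$
   Context: $\left(\frac{j}{3}\right)$ is the Legendre symbol modulo $3$: it equals $1$ if $j\equiv 1$, $-1$ if $j\equiv 2$, and $0$ if $j\equiv 0 \pmod 3$. $\arctan$ is the principal value, in $(-\pi/2,\pi/2)$. Convention: if $\alpha=\tan\frac{\pi j}{3n}$ (respectively $\beta=\tan\frac{\pi k}{3m}$) for some index, the base of the power is infinite and the corresponding $\arctan$ is interpreted as its limiting value $0$. *)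

theory Defs
  imports Complex_Main "HOL-Number_Theory.Residues"
begin

(* For x = t the base (x + t) / (x - t) is infinite, and the arctan is read as its limiting
   value 0.  The case is spelled out because division by zero yields 0 in HOL, which would
   give arctan (sqrt 3) instead.  When x, t > 0 and p is odd, the base, if finite, has absolute
   value greater than 1, so the denominator 1 + 2 * base ^ p is never 0. *)
definition arctan_term :: "nat \<Rightarrow> real \<Rightarrow> real \<Rightarrow> real" where
  "arctan_term p x t =
     (if x = t then 0 else arctan (sqrt 3 / (1 + 2 * ((x + t) / (x - t)) ^ p)))"

end

theory Submission
  imports Defs "HOL-Computational_Algebra.Polynomial"
begin

text \<open>
  Put \<open>u = x / t\<close> and let \<open>m = 2 l + 1\<close>. Since \<open>arctan (sqrt 3 / (1 + 2 z))\<close> is, modulo \<open>\<pi>\<close>, the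
  argument of \<open>z - w\<close> with \<open>w = cis (- 2 \<pi> / 3)\<close>, the term \<open>arctan_term m x t\<close> is governed by the
  argument of \<open>(u + 1) ^ m - w (u - 1) ^ m\<close>. This number is the product of the factors
  \<open>(u + 1) - \<zeta> (u - 1)\<close> over the \<open>m\<close>-th roots \<open>\<zeta>\<close> of \<open>w\<close>, which are \<open>cis (- 2 \<phi>)\<close> with
  \<open>\<phi> = \<pi> (3 j + 1) / (3 m)\<close> for \<open>- l \<le> j \<le> l\<close>. Each factor is a positive multiple of
  \<open>cis (arctan (u tan \<phi>) - \<phi>)\<close>. Comparing arguments identifies the term with the sum of these
  angles modulo \<open>2 \<pi>\<close>; both are continuous in \<open>u \<ge> 0\<close> and agree at \<open>u = 0\<close>, so they are
  equal (\<open>arctan_ratio_eq_sum\<close>). Pairing \<open>3 j + 1\<close> with its absolute value turns the sum over \<open>j\<close>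
  into a sum weighted by the Legendre symbol \<open>\<chi>\<close> modulo 3 (\<open>arctan_term_eq_sum\<close>):
  \<open>arctan_term m x t = - \<pi> / 3 + (\<Sum>k. \<chi> k * arctan (x / t * tan (\<pi> k / (3 m))))\<close>.

  With \<open>t j = tan (\<pi> j / (3 n))\<close> and \<open>s k = tan (\<pi> k / (3 m))\<close>, the two sums of the theorem
  become double sums, both with weights \<open>\<chi> j * \<chi> k\<close>, of the arctangents of \<open>\<alpha> s k / t j\<close> and of
  \<open>\<beta> t j / s k\<close>. These are positive and, as \<open>\<alpha> \<beta> = 1\<close>, reciprocal, so their arctangents add up to
  \<open>\<pi> / 2\<close>. Each of the two character sums is 1, hence the total is
  \<open>- \<pi> / 3 - \<pi> / 3 + \<pi> / 2 = - \<pi> / 6\<close>.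
\<close>

section \<open>The character modulo 3\<close>

lemma Legendre_3:
  "Legendre a 3 = (if a mod 3 = 0 then 0 else if a mod 3 = 1 then 1 else - 1)"
proof -
  have sq: "y\<^sup>2 mod 3 = (if y mod 3 = 0 then 0 else 1)" for y :: int
  proof -
    have "y mod 3 = 0 \<or> y mod 3 = 1 \<or> y mod 3 = 2" by presburger
    moreover have "y\<^sup>2 mod 3 = (y mod 3)\<^sup>2 mod 3" by (simp add: power_mod)
    ultimately show ?thesis by auto
  qed
  have "QuadRes 3 a \<longleftrightarrow> a mod 3 = 0 \<or> a mod 3 = 1"
  proof
    assume "QuadRes 3 a"
    then show "a mod 3 = 0 \<or> a mod 3 = 1"
      unfolding QuadRes_def cong_def sq by (auto split: if_splits)
  next
    assume "a mod 3 = 0 \<or> a mod 3 = 1"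
    then have "(0::int)\<^sup>2 mod 3 = a mod 3 \<or> (1::int)\<^sup>2 mod 3 = a mod 3" by auto
    then show "QuadRes 3 a" unfolding QuadRes_def cong_def by blast
  qed
  then show ?thesis by (auto simp: Legendre_def cong_def)
qed

lemma sum_Legendre_3_step:
  "(\<Sum>k = 1..3 * Suc l + 1. real_of_int (Legendre (int k) 3) * h k) =
    (\<Sum>k = 1..3 * l + 1. real_of_int (Legendre (int k) 3) * h k) - h (3 * l + 2) + h (3 * l + 4)"
proof -
  have "3 * Suc l + 1 = Suc (Suc (Suc (3 * l + 1)))" by simp
  moreover have "int (Suc (3 * l + 1)) mod 3 = 2" "int (Suc (Suc (3 * l + 1))) mod 3 = 0"
    "int (Suc (Suc (Suc (3 * l + 1)))) mod 3 = 1"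
    by presburger+
  ultimately show ?thesis
    by (simp add: Legendre_3 numeral_eq_Suc del: of_nat_Suc)
qed

lemma sum_Legendre_3: "(\<Sum>k = 1..3 * l + 1. real_of_int (Legendre (int k) 3)) = 1"
proof (induction l)
  case 0
  show ?case by (simp add: Legendre_3)
next
  case (Suc l)
  then show ?case using sum_Legendre_3_step[of "\<lambda>_. 1" l] by simp
qed

text \<open>
  The integers \<open>3 j + 1\<close> with \<open>- l \<le> j \<le> l\<close> have as absolute values exactly the numbers up to
  \<open>3 l + 1\<close> prime to 3, and the sign of \<open>3 j + 1\<close> is the Legendre symbol of that absolute value.
\<close>

lemma sum_Legendre_3_odd_function:
  fixes g :: "int \<Rightarrow> real"
  assumes odd: "\<And>x. g (- x) = - g x"
  shows "(\<Sum>k = 1..3 * l + 1. real_of_int (Legendre (int k) 3) * g (int k)) =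
    (\<Sum>j \<in> {- int l..int l}. g (3 * j + 1))"
proof (induction l)
  case 0
  show ?case by (simp add: Legendre_3)
next
  case (Suc l)
  have interval: "{- int (Suc l)..int (Suc l)} =
      insert (int l + 1) (insert (- int l - 1) {- int l..int l})"
    by auto
  have "g (3 * (- int l - 1) + 1) = - g (3 * int l + 2)"
    using odd[of "3 * int l + 2"] by (simp add: algebra_simps)
  then show ?case
    unfolding interval sum_Legendre_3_step Suc.IH by (simp add: algebra_simps)
qed

section \<open>Factorisation over the roots of a power\<close>

text \<open>
  For \<open>y \<noteq> 0\<close> both sides are the values at \<open>x\<close> of monic polynomials of degree \<open>m\<close> that share the \<open>m\<close>
  distinct zeros \<open>z a * y\<close>.
\<close>

lemma diff_power_eq_prod_roots:
  fixes x y w :: "'a :: idom"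
  assumes "finite A" and card: "card A = m" and "0 < m" and inj: "inj_on z A"
    and root: "\<And>a. a \<in> A \<Longrightarrow> z a ^ m = w"
  shows "x ^ m - w * y ^ m = (\<Prod>a\<in>A. x - z a * y)"
proof (cases "y = 0")
  case True
  then show ?thesis using assms by simp
next
  case False
  define p where "p = monom 1 m - [:w * y ^ m:]"
  define q where "q = (\<Prod>a\<in>A. [:- (z a * y), 1:])"
  have deg_q: "degree q = m"
    unfolding q_def by (subst degree_prod_eq_sum_degree) (auto simp: card)
  have lead_q: "lead_coeff q = 1"
    unfolding q_def by (simp add: lead_coeff_prod)
  have "p = q"
  proof (rule poly_eqI_degree_lead_coeff)
    show "coeff p m = coeff q m"
      using lead_q deg_q \<open>0 < m\<close> by (cases m) (auto simp: p_def)
    have "inj_on (\<lambda>a. z a * y) A" using inj False by (auto simp: inj_on_def)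
    then show "m \<le> card ((\<lambda>a. z a * y) ` A)" by (simp add: card_image card)
    show "degree p \<le> m"
      unfolding p_def by (intro degree_diff_le) (auto simp: degree_monom_le)
    show "degree q \<le> m" using deg_q by simp
  next
    fix v assume "v \<in> (\<lambda>a. z a * y) ` A"
    then obtain a where a: "a \<in> A" "v = z a * y" by auto
    have "poly q v = 0"
      unfolding q_def poly_prod using a assms(1) by (intro prod_zero) auto
    moreover have "poly p v = 0"
      using root[OF a(1)] a(2) by (simp add: p_def poly_monom power_mult_distrib)
    ultimately show "poly p v = poly q v" by simp
  qed
  then have "poly p x = poly q x" by simp
  then show ?thesis by (simp add: p_def q_def poly_monom poly_prod)
qed

section \<open>Arguments of complex numbers\<close>

lemma cis_eq_1_imp: "cis a = 1 \<Longrightarrow> \<exists>n::int. a = of_int n * 2 * pi"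
  using cos_one_2pi_int[of a] by (simp add: complex_eq_iff)

lemma Complex_1_eq_rcis_arctan: "Complex 1 x = rcis (sqrt (1 + x\<^sup>2)) (arctan x)"
proof -
  have "sqrt (1 + x\<^sup>2) \<noteq> 0"
    by (metis add_pos_nonneg less_numeral_extra(1,3) real_sqrt_gt_zero zero_le_power2)
  then show ?thesis by (simp add: complex_eq_iff cos_arctan sin_arctan)
qed

lemma prod_rcis: "(\<Prod>a\<in>A. rcis (r a) (t a)) = rcis (\<Prod>a\<in>A. r a) (\<Sum>a\<in>A. t a)"
  by (induction A rule: infinite_finite_induct) (simp_all add: rcis_mult)

lemma rcis_pos_eq:
  assumes "rcis r a = rcis s b" "0 < r" "0 < s"
  shows "cis (a - b) = 1"
proof -
  have "cmod (rcis r a) = cmod (rcis s b)" using assms by simp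
  then have "r = s" using assms(2,3) by simp
  then have "cis a = cis b" using assms by (simp add: rcis_def)
  then show ?thesis by (simp add: cis_divide[symmetric])
qed

text \<open>
  Taking out \<open>cis (- \<phi>)\<close> symmetrises the factor: \<open>1 + cis (- 2 \<phi>) = 2 cos \<phi> cis (- \<phi>)\<close> and
  \<open>1 - cis (- 2 \<phi>) = 2 \<i> sin \<phi> cis (- \<phi>)\<close>, so what remains is \<open>2 cos \<phi> (1 + \<i> u tan \<phi>)\<close>.
\<close>

lemma linear_factor_eq_rcis:
  fixes u \<phi> :: real
  assumes "cos \<phi> \<noteq> 0"
  shows "of_real (u + 1) - cis (- 2 * \<phi>) * of_real (u - 1) =
    rcis (2 * cos \<phi> * sqrt (1 + (u * tan \<phi>)\<^sup>2)) (arctan (u * tan \<phi>) - \<phi>)"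
proof -
  have "of_real (u + 1) - cis (- 2 * \<phi>) * of_real (u - 1) =
      rcis (2 * cos \<phi>) (- \<phi>) * Complex 1 (u * tan \<phi>)"
    (is "?lhs = ?rhs")
  proof (rule complex_eqI)
    have "Re ?lhs = (u + 1) - ((cos \<phi>)\<^sup>2 - (sin \<phi>)\<^sup>2) * (u - 1)"
      by (simp add: cos_double)
    also have "\<dots> = ((sin \<phi>)\<^sup>2 + (cos \<phi>)\<^sup>2) * (u + 1) - ((cos \<phi>)\<^sup>2 - (sin \<phi>)\<^sup>2) * (u - 1)"
      by (simp only: sin_cos_squared_add mult_1)
    also have "\<dots> = 2 * (cos \<phi>)\<^sup>2 + 2 * u * (sin \<phi>)\<^sup>2"
      by (simp add: algebra_simps del: sin_cos_squared_add sin_cos_squared_add2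
        sin_cos_squared_add3)
    also have "\<dots> = Re ?rhs"
      using assms by (simp add: tan_def power2_eq_square)
    finally show "Re ?lhs = Re ?rhs" .
    have "Im ?lhs = 2 * sin \<phi> * cos \<phi> * (u - 1)"
      by (simp add: sin_double)
    also have "\<dots> = Im ?rhs"
      using assms by (simp add: tan_def algebra_simps)
    finally show "Im ?lhs = Im ?rhs" .
  qed
  then show ?thesis
    by (simp add: Complex_1_eq_rcis_arctan rcis_mult add.commute)
qed

section \<open>One term as a sum of arctangents\<close>

text \<open>
  Clearing the power \<open>(u - 1) ^ m\<close> from the denominators removes the singularity at \<open>u = 1\<close>, that is
  at \<open>x = t\<close>, where the value is the conventional 0, and makes the term continuous for all \<open>u \<ge> 0\<close>.
\<close>

definition arctan_ratio :: "nat \<Rightarrow> real \<Rightarrow> real" where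
  "arctan_ratio m u = arctan (sqrt 3 * (u - 1) ^ m / ((u - 1) ^ m + 2 * (u + 1) ^ m))"

lemma arctan_ratio_denominator_pos:
  fixes u :: real
  assumes "0 \<le> u"
  shows "0 < (u - 1) ^ m + 2 * (u + 1) ^ m"
proof -
  have "\<bar>u - 1\<bar> ^ m \<le> (u + 1) ^ m" using assms by (intro power_mono) auto
  then have "\<bar>(u - 1) ^ m\<bar> \<le> (u + 1) ^ m" by (simp add: power_abs)
  moreover have "0 < (u + 1) ^ m" using assms by simp
  ultimately show ?thesis by linarith
qed

lemma arctan_term_eq_arctan_ratio:
  assumes "0 < x" "0 < t" "0 < m"
  shows "arctan_term m x t = arctan_ratio m (x / t)"
proof (cases "x = t")
  case True
  then show ?thesis using assms by (simp add: arctan_term_def arctan_ratio_def)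
next
  case False
  define A B where "A = (x / t + 1) ^ m" and "B = (x / t - 1) ^ m"
  have "(x + t) / (x - t) = (x / t + 1) / (x / t - 1)"
    using assms False by (simp add: field_simps)
  then have pow: "((x + t) / (x - t)) ^ m = A / B"
    by (simp add: power_divide A_def B_def)
  have "B \<noteq> 0" using False assms by (simp add: B_def)
  then have "1 + 2 * (A / B) = (B + 2 * A) / B" by (simp add: field_simps)
  then have "sqrt 3 / (1 + 2 * (A / B)) = sqrt 3 * B / (B + 2 * A)" by simp
  then show ?thesis
    using False pow by (simp add: arctan_term_def arctan_ratio_def A_def B_def)
qed

text \<open>
  The real part of the number on the left is half of the denominator in \<open>arctan_ratio\<close>. It is
  positive, so the arctangent is an argument exactly and not merely modulo \<open>\<pi>\<close>.
\<close>

lemma arctan_ratio_eq_rcis: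
  fixes u :: real
  assumes "0 \<le> u"
  shows "\<exists>r>0. of_real ((u + 1) ^ m) - cis (- 2 * pi / 3) * of_real ((u - 1) ^ m) =
    rcis r (arctan_ratio m u)"
proof -
  define D where "D = (u - 1) ^ m + 2 * (u + 1) ^ m"
  define v where "v = sqrt 3 * (u - 1) ^ m / D"
  have D: "0 < D" unfolding D_def by (rule arctan_ratio_denominator_pos[OF assms])
  have c: "cos (2 * pi / 3) = - 1 / 2" "sin (2 * pi / 3) = sqrt 3 / 2"
    using cos_120 sin_120 by simp_all
  have "of_real ((u + 1) ^ m) - cis (- 2 * pi / 3) * of_real ((u - 1) ^ m) =
      rcis (D / 2) 0 * Complex 1 v"
    using D by (simp add: complex_eq_iff c v_def) (simp add: D_def)
  also have "\<dots> = rcis (D / 2 * sqrt (1 + v\<^sup>2)) (arctan v)"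
    unfolding Complex_1_eq_rcis_arctan rcis_mult by simp
  also have "arctan v = arctan_ratio m u"
    by (simp add: arctan_ratio_def v_def D_def)
  finally show ?thesis
    using D by (intro exI[of _ "D / 2 * sqrt (1 + v\<^sup>2)"]) (auto simp: add_pos_nonneg)
qed

text \<open>
  The values of \<open>h\<close> lie in the discrete set of multiples of \<open>2 \<pi>\<close>; leaving 0 would force \<open>h\<close> through
  \<open>\<pi>\<close> or \<open>- \<pi>\<close>.
\<close>

lemma continuous_cis_eq_1_imp_zero:
  fixes h :: "real \<Rightarrow> real"
  assumes cont: "continuous_on {0..u} h" and "0 \<le> u" and h0: "h 0 = 0"
    and cis: "\<And>v. v \<in> {0..u} \<Longrightarrow> cis (h v) = 1"
  shows "h u = 0"
proof (rule ccontr)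
  assume "h u \<noteq> 0"
  obtain n :: int where n: "h u = of_int n * 2 * pi"
    using cis_eq_1_imp cis[of u] \<open>0 \<le> u\<close> by fastforce
  have conn: "connected (h ` {0..u})"
    using cont by (intro connected_continuous_image) auto
  have ends: "0 \<in> h ` {0..u}" "h u \<in> h ` {0..u}"
    using h0 \<open>0 \<le> u\<close> by (force, auto)
  have "pi \<in> h ` {0..u} \<or> - pi \<in> h ` {0..u}"
  proof (cases "0 < n")
    case True
    then have "1 * pi \<le> of_int n * 2 * pi" by (intro mult_right_mono) auto
    then have "pi \<in> {0..h u}" using n by simp
    then show ?thesis using connected_contains_Icc[OF conn ends] by blast
  next
    case False
    then have "n \<le> - 1" using n \<open>h u \<noteq> 0\<close> by (cases "n = 0") auto
    then have "of_int n * 2 * pi \<le> - 1 * pi" by (intro mult_right_mono) auto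
    then have "- pi \<in> {h u..0}" using n by simp
    then show ?thesis using connected_contains_Icc[OF conn ends(2,1)] by blast
  qed
  then have "cis pi = 1 \<or> cis (- pi) = 1" using cis by force
  then show False by (simp add: complex_eq_iff)
qed

lemma sum_arith_progression: "(\<Sum>j \<in> {- int l..int l}. 3 * j + 1) = 2 * int l + 1"
proof (induction l)
  case 0
  show ?case by simp
next
  case (Suc l)
  have interval: "{- int (Suc l)..int (Suc l)} =
      insert (int l + 1) (insert (- int l - 1) {- int l..int l})"
    by auto
  show ?case unfolding interval using Suc.IH by simp
qed

text \<open>
  The constant \<open>- \<pi> / 3\<close> arises twice, and the agreement fixes the multiple of \<open>2 \<pi>\<close>: it is minus the
  sum of the angles \<open>\<phi> j\<close>, and it is the value \<open>arctan (- sqrt 3)\<close> of the left-hand side at \<open>u = 0\<close>,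
  where the parity of \<open>m\<close> gives \<open>(- 1) ^ m = - 1\<close>.
\<close>

lemma arctan_ratio_eq_sum:
  fixes u :: real and l :: nat
  assumes "0 \<le> u"
  defines "m \<equiv> 2 * l + 1"
  shows "arctan_ratio m u = - (pi / 3) +
    (\<Sum>j \<in> {- int l..int l}. arctan (u * tan (pi * of_int (3 * j + 1) / (3 * real m))))"
proof -
  define J where "J = {- int l..int l}"
  define \<phi> where "\<phi> j = pi * of_int (3 * j + 1) / (3 * real m)" for j :: int
  define S where "S v = (\<Sum>j\<in>J. arctan (v * tan (\<phi> j)))" for v
  have m: "0 < m" "odd m" by (auto simp: m_def)
  \<comment> \<open>The choice of representatives around 0 keeps every \<open>\<phi> j\<close> between \<open>- \<pi> / 2\<close> and \<open>\<pi> / 2\<close>,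
      so each linear factor is a positive multiple of the \<open>cis\<close> of its angle.\<close>
  have cos_pos: "0 < cos (\<phi> j)" if "j \<in> J" for j
  proof (rule cos_gt_zero_pi)
    have "\<bar>6 * j + 2\<bar> < 3 * int m" using that by (auto simp: J_def m_def)
    then have "real_of_int \<bar>6 * j + 2\<bar> < real_of_int (3 * int m)" by linarith
    then have "- (3 * real m) < 6 * real_of_int j + 2" "6 * real_of_int j + 2 < 3 * real m"
      by auto
    then have "pi * (- (3 * real m)) < pi * (6 * real_of_int j + 2)"
      "pi * (6 * real_of_int j + 2) < pi * (3 * real m)"
      by (simp_all only: mult_less_cancel_left_pos pi_gt_zero)
    then show "- (pi / 2) < \<phi> j" "\<phi> j < pi / 2"
      using m by (simp_all add: \<phi>_def field_simps)
  qed
  have inj: "inj_on (\<lambda>j. cis (- 2 * \<phi> j)) J"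
  proof (rule inj_onI)
    fix i j assume ij: "i \<in> J" "j \<in> J" and "cis (- 2 * \<phi> i) = cis (- 2 * \<phi> j)"
    then have "cis (- 2 * \<phi> i - - 2 * \<phi> j) = 1"
      by (simp only: cis_divide[symmetric]) simp
    then obtain n :: int where n: "- 2 * \<phi> i - - 2 * \<phi> j = of_int n * 2 * pi"
      using cis_eq_1_imp by blast
    have "- 2 * \<phi> i - - 2 * \<phi> j = 2 * pi / real m * real_of_int (j - i)"
      using m by (simp add: \<phi>_def field_simps)
    then have "2 * pi * real_of_int (j - i) = 2 * pi * real_of_int (n * int m)"
      unfolding n using m by (simp add: field_simps)
    then have "real_of_int (j - i) = real_of_int (n * int m)"
      by (simp only: mult_cancel_left) simp
    then have eq: "j - i = n * int m" by (simp only: of_int_eq_iff)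
    \<comment> \<open>Two indices are congruent modulo \<open>m\<close> but less than \<open>m\<close> apart.\<close>
    have "\<bar>j - i\<bar> < int m" using ij by (auto simp: J_def m_def)
    then have "n = 0" using eq zdvd_not_zless dvd_imp_le_int[of "j - i" "int m"] m by auto
    then show "i = j" using eq by simp
  qed
  have root: "cis (- 2 * \<phi> j) ^ m = cis (- 2 * pi / 3)" for j
  proof -
    have "real m * (- 2 * \<phi> j) = - 2 * pi / 3 + 2 * pi * of_int (- j)"
      using m by (simp add: \<phi>_def field_simps)
    then have "cis (- 2 * \<phi> j) ^ m = cis (- 2 * pi / 3 + 2 * pi * of_int (- j))"
      by (simp only: Complex.DeMoivre)
    also have "\<dots> = cis (- 2 * pi / 3)"
      by (simp only: cis_mult[symmetric] cis_multiple_2pi[OF Ints_of_int]) simp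
    finally show ?thesis .
  qed
  have sum_\<phi>: "(\<Sum>j\<in>J. \<phi> j) = pi / 3"
  proof -
    have "(\<Sum>j\<in>J. \<phi> j) = pi / (3 * real m) * real_of_int (\<Sum>j\<in>J. 3 * j + 1)"
      by (simp add: \<phi>_def sum_distrib_left)
    also have "\<dots> = pi / 3"
    proof -
      have "real_of_int (2 * int l + 1) = real m" by (simp add: m_def)
      then show ?thesis unfolding J_def sum_arith_progression using m by simp
    qed
    finally show ?thesis .
  qed
  have same_argument: "cis (arctan_ratio m v - (S v - pi / 3)) = 1" if "0 \<le> v" for v
  proof -
    obtain r where r: "0 < r"
      "of_real ((v + 1) ^ m) - cis (- 2 * pi / 3) * of_real ((v - 1) ^ m) =
        rcis r (arctan_ratio m v)"
      using arctan_ratio_eq_rcis[OF \<open>0 \<le> v\<close>] by blast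
    define s where "s = (\<Prod>j\<in>J. 2 * cos (\<phi> j) * sqrt (1 + (v * tan (\<phi> j))\<^sup>2))"
    have "rcis r (arctan_ratio m v) =
        (\<Prod>j\<in>J. of_real (v + 1) - cis (- 2 * \<phi> j) * of_real (v - 1))"
      unfolding r(2)[symmetric] of_real_power
      by (rule diff_power_eq_prod_roots[OF _ _ m(1) inj root]) (auto simp: J_def m_def)
    also have "\<dots> = (\<Prod>j\<in>J. rcis (2 * cos (\<phi> j) * sqrt (1 + (v * tan (\<phi> j))\<^sup>2))
        (arctan (v * tan (\<phi> j)) - \<phi> j))"
      using cos_pos by (intro prod.cong refl linear_factor_eq_rcis) force
    also have "\<dots> = rcis s (S v - pi / 3)"
      by (simp add: prod_rcis s_def S_def sum_subtractf sum_\<phi>)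
    finally have "rcis r (arctan_ratio m v) = rcis s (S v - pi / 3)" .
    moreover have "0 < s"
      unfolding s_def by (intro prod_pos) (auto simp: cos_pos add_pos_nonneg)
    ultimately show ?thesis using rcis_pos_eq r(1) by blast
  qed
  have "arctan_ratio m u - (S u - pi / 3) = 0"
  proof (rule continuous_cis_eq_1_imp_zero[OF _ \<open>0 \<le> u\<close>])
    show "continuous_on {0..u} (\<lambda>v. arctan_ratio m v - (S v - pi / 3))"
      unfolding arctan_ratio_def S_def
      by (intro continuous_intros)
        (metis arctan_ratio_denominator_pos atLeastAtMost_iff less_irrefl)
    show "arctan_ratio m 0 - (S 0 - pi / 3) = 0"
    proof -
      have "arctan (sqrt 3) = pi / 3"
        using pi_gt_zero by (intro arctan_unique) (simp_all add: tan_60 del: pi_gt_zero)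
      then show ?thesis using m by (simp add: arctan_ratio_def S_def arctan_minus)
    qed
    show "cis (arctan_ratio m v - (S v - pi / 3)) = 1" if "v \<in> {0..u}" for v
      using that by (intro same_argument) simp
  qed
  then show ?thesis by (simp add: S_def J_def \<phi>_def)
qed

lemma arctan_term_eq_sum:
  assumes "0 < x" "0 < t" "odd m"
  shows "arctan_term m x t = - (pi / 3) + (\<Sum>k = 1..(3 * m - 1) div 2.
    real_of_int (Legendre (int k) 3) * arctan (x / t * tan (pi * real k / (3 * real m))))"
proof -
  obtain l where l: "m = 2 * l + 1" using \<open>odd m\<close> by (rule oddE)
  define g :: "int \<Rightarrow> real" where "g k = arctan (x / t * tan (pi * of_int k / (3 * real m)))" for k
  have "g (- k) = - g k" for k by (simp add: g_def arctan_minus)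
  note fold = sum_Legendre_3_odd_function[of g, OF this, of l]
  have upper: "(3 * m - 1) div 2 = 3 * l + 1" by (simp add: l)
  have "arctan_term m x t = arctan_ratio m (x / t)"
    using assms by (intro arctan_term_eq_arctan_ratio) (auto simp: l)
  also have "\<dots> = - (pi / 3) + (\<Sum>j \<in> {- int l..int l}. g (3 * j + 1))"
    unfolding g_def l using assms by (intro arctan_ratio_eq_sum) simp
  also have "\<dots> = - (pi / 3) +
      (\<Sum>k = 1..(3 * m - 1) div 2. real_of_int (Legendre (int k) 3) * g (int k))"
    unfolding upper fold ..
  finally show ?thesis by (simp add: g_def)
qed

section \<open>The reciprocity law\<close>

lemma tan_third_pos:
  assumes "odd m" "k \<in> {1..(3 * m - 1) div 2}"
  shows "0 < tan (pi * real k / (3 * real m))"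
proof (rule tan_gt_zero)
  have "0 < m" using assms by (cases m) auto
  have "2 * k < 3 * m" "1 \<le> k" using assms \<open>0 < m\<close> by auto
  then have "2 * real k < 3 * real m" by linarith
  then show "pi * real k / (3 * real m) < pi / 2" using \<open>0 < m\<close> by (simp add: field_simps)
  show "0 < pi * real k / (3 * real m)" using \<open>0 < m\<close> \<open>1 \<le> k\<close> by simp
qed

lemma arctan_add_inverse:
  assumes "0 < x" "x * y = 1"
  shows "arctan x + arctan y = pi / 2"
proof -
  have "y = 1 / x" using assms by (simp add: field_simps)
  then show ?thesis using arctan_inverse[of x] assms(1) by simp
qed

lemma sum_Legendre_3_half:
  assumes "odd m"
  shows "(\<Sum>k = 1..(3 * m - 1) div 2. real_of_int (Legendre (int k) 3)) = 1"
proof -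
  obtain l where "m = 2 * l + 1" using assms by (rule oddE)
  then have "(3 * m - 1) div 2 = 3 * l + 1" by simp
  then show ?thesis by (simp only: sum_Legendre_3)
qed

theorem theorem3:
  fixes n m :: nat and \<alpha> \<beta> :: real
  assumes "0 < n" and "odd n" and "0 < m" and "odd m"
    and "\<alpha> > 0" and "\<alpha> * \<beta> = 1"
  shows "(\<Sum>j = 1..(3 * n - 1) div 2.
            real_of_int (Legendre (int j) 3) * arctan_term m \<alpha> (tan (pi * real j / (3 * real n))))
       + (\<Sum>k = 1..(3 * m - 1) div 2.
            real_of_int (Legendre (int k) 3) * arctan_term n \<beta> (tan (pi * real k / (3 * real m))))
       = - (pi / 6)"
proof -
  define N M where "N = {1..(3 * n - 1) div 2}" and "M = {1..(3 * m - 1) div 2}"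
  define \<chi> where "\<chi> k = real_of_int (Legendre (int k) 3)" for k :: nat
  define t where "t j = tan (pi * real j / (3 * real n))" for j :: nat
  define s where "s k = tan (pi * real k / (3 * real m))" for k :: nat
  have "0 < \<beta>" using assms(5,6) by (metis zero_less_mult_pos zero_less_one)
  have t_pos: "0 < t j" if "j \<in> N" for j
    using that assms(2) unfolding t_def N_def by (intro tan_third_pos)
  have s_pos: "0 < s k" if "k \<in> M" for k
    using that assms(4) unfolding s_def M_def by (intro tan_third_pos)
  have \<chi>_sums: "sum \<chi> N = 1" "sum \<chi> M = 1"
    unfolding \<chi>_def N_def M_def using assms sum_Legendre_3_half by auto
  have first: "(\<Sum>j\<in>N. \<chi> j * arctan_term m \<alpha> (t j)) =
      - (pi / 3) + (\<Sum>j\<in>N. \<Sum>k\<in>M. \<chi> j * \<chi> k * arctan (\<alpha> / t j * s k))"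
  proof -
    have "(\<Sum>j\<in>N. \<chi> j * arctan_term m \<alpha> (t j)) =
        (\<Sum>j\<in>N. \<chi> j * (- (pi / 3)) + (\<Sum>k\<in>M. \<chi> j * \<chi> k * arctan (\<alpha> / t j * s k)))"
      by (intro sum.cong refl)
        (simp add: arctan_term_eq_sum[OF \<open>\<alpha> > 0\<close> t_pos \<open>odd m\<close>] \<chi>_def s_def M_def
          distrib_left right_diff_distrib sum_distrib_left mult.assoc)
    also have "\<dots> = sum \<chi> N * (- (pi / 3)) + (\<Sum>j\<in>N. \<Sum>k\<in>M. \<chi> j * \<chi> k * arctan (\<alpha> / t j * s k))"
      by (simp only: sum.distrib sum_distrib_right)
    finally show ?thesis by (simp add: \<chi>_sums)
  qed
  have second: "(\<Sum>k\<in>M. \<chi> k * arctan_term n \<beta> (s k)) =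
      - (pi / 3) + (\<Sum>j\<in>N. \<Sum>k\<in>M. \<chi> j * \<chi> k * arctan (\<beta> / s k * t j))"
  proof -
    have "(\<Sum>k\<in>M. \<chi> k * arctan_term n \<beta> (s k)) =
        (\<Sum>k\<in>M. \<chi> k * (- (pi / 3)) + (\<Sum>j\<in>N. \<chi> j * \<chi> k * arctan (\<beta> / s k * t j)))"
      by (intro sum.cong refl)
        (simp add: arctan_term_eq_sum[OF \<open>0 < \<beta>\<close> s_pos \<open>odd n\<close>] \<chi>_def t_def N_def
          distrib_left right_diff_distrib sum_distrib_left mult.assoc mult.left_commute)
    also have "\<dots> = sum \<chi> M * (- (pi / 3)) + (\<Sum>k\<in>M. \<Sum>j\<in>N. \<chi> j * \<chi> k * arctan (\<beta> / s k * t j))"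
      by (simp only: sum.distrib sum_distrib_right)
    finally show ?thesis by (simp add: \<chi>_sums sum.swap[of _ M N])
  qed
  have "arctan (\<alpha> / t j * s k) + arctan (\<beta> / s k * t j) = pi / 2" if "j \<in> N" "k \<in> M" for j k
    using t_pos[OF that(1)] s_pos[OF that(2)] assms(5,6)
    by (intro arctan_add_inverse) (auto simp: field_simps)
  then have "(\<Sum>j\<in>N. \<Sum>k\<in>M. \<chi> j * \<chi> k * arctan (\<alpha> / t j * s k))
      + (\<Sum>j\<in>N. \<Sum>k\<in>M. \<chi> j * \<chi> k * arctan (\<beta> / s k * t j))
      = (\<Sum>j\<in>N. \<Sum>k\<in>M. \<chi> j * \<chi> k * (pi / 2))"
    unfolding sum.distrib[symmetric] distrib_left[symmetric] by (intro sum.cong refl) simp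
  also have "\<dots> = sum \<chi> N * sum \<chi> M * (pi / 2)"
    by (subst sum_product) (simp only: sum_distrib_right)
  finally have "(\<Sum>j\<in>N. \<chi> j * arctan_term m \<alpha> (t j)) + (\<Sum>k\<in>M. \<chi> k * arctan_term n \<beta> (s k)) = - (pi / 6)"
    by (simp add: first second \<chi>_sums)
  then show ?thesis by (simp only: N_def M_def \<chi>_def t_def s_def)
qed

end
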